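(* Let $\varepsilon>0$, let $s_1^{\varepsilon}$ be the $\varepsilon$-good strategy of the first player and let $s_2,s_3:S\to\{I,NI\}$ be arbitrary strategies of players 2 and 3. Then for every $x_1\in S$ the trajectory $\bar{x}_T=\bar{x}_T((s_1^{\varepsilon},s_2,s_3),x_1)$, with coordinates $\bar{x}_T=(\bar{x}_T^1,\bar{x}_T^2,\bar{x}_T^3)$, satisfies $$\liminf_{T\to\infty}\bar{x}^1_T\geq r_0,$$ $$\limsup_{T\to\infty}(\bar{x}^2_T+\bar{x}^3_T)\leq 2p_3,$$ $$\lim_{T\to\infty}\mathrm{dist}(\bar{x}_T,V_1)=0.$$
   Context: Stage game. There are three players $1,2,3$, each with the two actions $I$ (invest) and $NI$ (not invest). The game is symmetric: if exactly $n$ players invest, each investing player receives $p_n$ ($n=1,2,3$) and each non-investing player receives $r_n$ ($n=0,1,2$). Let $G:\{I,NI\}^3\to\mathbb{R}^3$ be the resulting vector payoff function (coordinate $i$ of $G(a)$ is the payoff of player $i$ under action profile $a$). Standing assumptions on the real numbers $r_0,r_1,r_2,p_1,p_2,p_3$: $0<r_0<r_1<r_2$; $0<p_1<p_2<p_3$; $p_1<r_0$; $3r_0<p_1+2r_1<2p_2+r_2<3p_3$; $p_1+r_1<2p_3$; $p_2<r_2$. Let $S\subset\mathbb{R}^3$ be the convex hull of the eight payoff vectors $G(a)$, $a\in\{I,NI\}^3$. Repeated game. A strategy of player $i$ is an arbitrary function $s_i:S\to\{I,NI\}$; a strategy profile is $s=(s_1,s_2,s_3):S\to\{I,NI\}^3$.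 Put $\varphi=G\circ s:S\to S$. For $x_1\in S$ the trajectory $\bar{x}_n=\bar{x}_n(s,x_1)$ is defined by $\bar{x}_1=x_1$ and $\bar{x}_{n+1}=\frac{n\bar{x}_n+\varphi(\bar{x}_n)}{n+1}$ for $n\ge 1$. $\varepsilon$-good strategy. For $\varepsilon>0$ and $\{i,j,k\}=\{1,2,3\}$ let $\Omega_i^{\varepsilon}=\{x\in S: x_i>x_j-\varepsilon \text{ and } x_i>x_k-\varepsilon\}$, $W_i=\{x\in S: x_i<r_0 \text{ or } x_j+x_k>2p_3\}$, $V_i=\Omega_i^{\varepsilon}\setminus W_i$. The $\varepsilon$-good strategy of player $i$ is $s_i^{\varepsilon}(x)=I$ if $x\in V_i$ and $s_i^{\varepsilon}(x)=NI$ if $x\in S\setminus V_i$. $\mathrm{dist}(x,A)=\inf_{a\in A}|x-a|$ is the Euclidean distance. *)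

theory Defs
  imports "HOL-Analysis.Analysis"
begin

datatype action = Invest | NotInvest

text \<open>
  The players are the three elements 1, 2, 3 of the type 3 (in which 3 = 0), and an action
  profile is a function from players to actions. In \<open>payoff r p\<close> only the values
  \<open>r 0, r 1, r 2\<close> and \<open>p 1, p 2, p 3\<close> are ever used.
\<close>

definition payoff :: "(nat \<Rightarrow> real) \<Rightarrow> (nat \<Rightarrow> real) \<Rightarrow> (3 \<Rightarrow> action) \<Rightarrow> real^3" where
  "payoff r p a = (\<chi> i. if a i = Invest then p (card {j. a j = Invest})
                          else r (card {j. a j = Invest}))"

definition payoff_hull :: "(nat \<Rightarrow> real) \<Rightarrow> (nat \<Rightarrow> real) \<Rightarrow> (real^3) set" where
  "payoff_hull r p = convex hull (range (payoff r p))"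

text \<open>
  A strategy is a map from \<open>payoff_hull r p\<close> to actions. It is represented by a total function
  on \<open>real^3\<close>, whose values outside the hull play no role: a trajectory that starts in the hull
  stays in it.
\<close>

type_synonym strategy = "real^3 \<Rightarrow> action"

definition strategy_profile :: "strategy \<Rightarrow> strategy \<Rightarrow> strategy \<Rightarrow> real^3 \<Rightarrow> 3 \<Rightarrow> action" where
  "strategy_profile s1 s2 s3 x i = (if i = 1 then s1 x else if i = 2 then s2 x else s3 x)"

text \<open>
  Trajectories are indexed from 1, as in the recursion
  \<open>x\<^sub>n\<^sub>+\<^sub>1 = (n x\<^sub>n + \<phi> x\<^sub>n) / (n + 1)\<close> for \<open>n \<ge> 1\<close>; the value at 0 is a dummy.
\<close>

fun trajectory :: "(real^3 \<Rightarrow> real^3) \<Rightarrow> real^3 \<Rightarrow> nat \<Rightarrow> real^3" where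
  "trajectory \<phi> x1 0 = x1"
| "trajectory \<phi> x1 (Suc 0) = x1"
| "trajectory \<phi> x1 (Suc (Suc m)) =
     (let n = Suc m; x = trajectory \<phi> x1 n
      in (1 / (real n + 1)) *\<^sub>R (real n *\<^sub>R x + \<phi> x))"

definition \<Omega>_set :: "(nat \<Rightarrow> real) \<Rightarrow> (nat \<Rightarrow> real) \<Rightarrow> real \<Rightarrow> 3 \<Rightarrow> (real^3) set" where
  "\<Omega>_set r p \<epsilon> i = {x \<in> payoff_hull r p. \<forall>j. j \<noteq> i \<longrightarrow> x $ i > x $ j - \<epsilon>}"

definition W_set :: "(nat \<Rightarrow> real) \<Rightarrow> (nat \<Rightarrow> real) \<Rightarrow> 3 \<Rightarrow> (real^3) set" where
  "W_set r p i = {x \<in> payoff_hull r p. x $ i < r 0 \<or> (\<Sum>j\<in>UNIV - {i}. x $ j) > 2 * p 3}"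

text \<open>
  Under the standing assumptions \<open>V_set r p \<epsilon> i\<close> contains the point \<open>(p 3, p 3, p 3)\<close>, so the
  library convention \<open>infdist x {} = 0\<close> does not matter for distances to it.
\<close>

definition V_set :: "(nat \<Rightarrow> real) \<Rightarrow> (nat \<Rightarrow> real) \<Rightarrow> real \<Rightarrow> 3 \<Rightarrow> (real^3) set" where
  "V_set r p \<epsilon> i = \<Omega>_set r p \<epsilon> i - W_set r p i"

definition good_strategy :: "(nat \<Rightarrow> real) \<Rightarrow> (nat \<Rightarrow> real) \<Rightarrow> real \<Rightarrow> 3 \<Rightarrow> strategy" where
  "good_strategy r p \<epsilon> i x = (if x \<in> V_set r p \<epsilon> i then Invest else NotInvest)"

end

theory Submission
  imports Defs
begin

text \<open>
  The set \<open>V_set r p \<epsilon> 1\<close> is convex and contains every payoff vector that can occur when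
  player 1 does not invest. Hence, as long as the trajectory is outside this set, each step averages
  it with a point of the set, which multiplies the distance by at most \<open>n / (n + 1)\<close>; from inside the
  set, a step has length \<open>O(1 / n)\<close>. Therefore \<open>n\<close> times the distance stays bounded.
\<close>

lemma convex_scaled_average:
  fixes x y :: "'a::real_vector"
  assumes "convex A" "x \<in> A" "y \<in> A"
  shows "(1 / (real n + 1)) *\<^sub>R (real n *\<^sub>R x + y) \<in> A"
proof -
  have "(real n / (real n + 1)) *\<^sub>R x + (1 / (real n + 1)) *\<^sub>R y \<in> A"
    using assms by (intro convexD) (auto simp flip: add_divide_distrib)
  then show ?thesis
    by (simp add: scaleR_add_right)
qed

lemma le_infdist:
  assumes "A \<noteq> {}" "\<And>a. a \<in> A \<Longrightarrow> d \<le> dist x a"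
  shows "d \<le> infdist x A"
  using assms by (simp add: infdist_notempty cINF_greatest)

text \<open>Averaging with a fixed \<open>u\<close> in \<open>V\<close> maps the convex set
  \<open>V\<close> into itself and scales distances by \<open>n / (n + 1)\<close>, so each
  competitor \<open>v\<close> for \<open>x\<close> yields the competitor \<open>w\<close> for the
  average. For \<open>n = 0\<close> the average is \<open>u\<close> itself.\<close>

lemma infdist_average_le:
  fixes x u :: "'a::real_normed_vector"
  assumes "convex V" "u \<in> V"
  shows "(real n + 1) * infdist ((1 / (real n + 1)) *\<^sub>R (real n *\<^sub>R x + u)) V \<le> real n * infdist x V"
proof (cases "n = 0")
  case True
  then show ?thesis using assms by simp
next
  case False
  define y where "y = (1 / (real n + 1)) *\<^sub>R (real n *\<^sub>R x + u)"
  have "(real n + 1) / real n * infdist y V \<le> infdist x V"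
  proof (rule le_infdist)
    show "V \<noteq> {}" using assms by auto
    fix v assume v: "v \<in> V"
    define w where "w = (1 / (real n + 1)) *\<^sub>R (real n *\<^sub>R v + u)"
    have "w \<in> V"
      unfolding w_def using assms v by (intro convex_scaled_average)
    then have "infdist y V \<le> dist y w"
      by (rule infdist_le)
    also have "y - w = (real n / (real n + 1)) *\<^sub>R (x - v)"
      by (simp add: y_def w_def algebra_simps)
    then have "dist y w = real n / (real n + 1) * dist x v"
      by (simp add: dist_norm)
    finally show "(real n + 1) / real n * infdist y V \<le> dist x v"
      using False by (simp add: field_simps)
  qed
  then show ?thesis
    using False by (simp add: y_def field_simps)
qed

lemma averaging_infdist_tendsto_0:
  fixes X u :: "nat \<Rightarrow> 'a::real_normed_vector"
  assumes V: "convex V"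
    and step: "\<And>n. n \<ge> 1 \<Longrightarrow> X (Suc n) = (1 / (real n + 1)) *\<^sub>R (real n *\<^sub>R X n + u n)"
    and outside: "\<And>n. X n \<notin> V \<Longrightarrow> u n \<in> V"
    and inside: "\<And>n. X n \<in> V \<Longrightarrow> dist (u n) (X n) \<le> D"
  shows "(\<lambda>n. infdist (X n) V) \<longlonglongrightarrow> 0"
proof -
  \<comment> \<open>\<open>D\<close> bounds the scaled distance after a step that starts in
    \<open>V\<close>; the initial distance bounds it until the first visit to
    \<open>V\<close>.\<close>
  define C where "C = max D (infdist (X 1) V)"
  have bound: "real n * infdist (X n) V \<le> C" if "n \<ge> 1" for n
    using that
  proof (induction n rule: dec_induct)
    case base
    then show ?case by (simp add: C_def)
  next
    case (step n)
    note avg = assms(2)[OF \<open>1 \<le> n\<close>]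
    show ?case
    proof (cases "X n \<in> V")
      case True
      have "(real n + 1) *\<^sub>R (X (Suc n) - X n) = u n - X n"
        using avg by (simp add: scaleR_diff_right scaleR_add_left)
      then have "(real n + 1) * dist (X (Suc n)) (X n) = dist (u n) (X n)"
        by (metis abs_of_nat dist_norm norm_scaleR of_nat_Suc add.commute)
      moreover have "infdist (X (Suc n)) V \<le> dist (X (Suc n)) (X n)"
        using True by (rule infdist_le)
      ultimately have "real (Suc n) * infdist (X (Suc n)) V \<le> dist (u n) (X n)"
        by (metis add.commute mult_left_mono of_nat_0_le_iff of_nat_Suc)
      also have "\<dots> \<le> C"
        using inside[OF True] by (simp add: C_def)
      finally show ?thesis .
    next
      case False
      have "real (Suc n) * infdist (X (Suc n)) V \<le> real n * infdist (X n) V"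
        using infdist_average_le[OF V outside[OF False], of n "X n"] avg
        by (simp add: add.commute)
      with step.IH show ?thesis by linarith
    qed
  qed
  show ?thesis
  proof (rule tendsto_sandwich[where f = "\<lambda>_. 0"])
    show "\<forall>\<^sub>F n in sequentially. infdist (X n) V \<le> C / real n"
      using eventually_ge_at_top[of 1] by eventually_elim (use bound in \<open>simp add: field_simps\<close>)
    show "(\<lambda>n. C / real n) \<longlonglongrightarrow> 0"
      by (rule lim_const_over_n)
  qed (auto simp: infdist_nonneg)
qed

text \<open>This makes the payoff hull the convex hull of finitely many points, hence bounded, which
  supplies the step bound \<open>D\<close>.\<close>

lemma finite_action_profiles: "finite (UNIV :: (3 \<Rightarrow> action) set)"
proof -
  have "UNIV = (PiE UNIV (\<lambda>_. {Invest, NotInvest}) :: (3 \<Rightarrow> action) set)"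
    using action.exhaust by (auto simp: PiE_UNIV_domain)
  also have "finite \<dots>"
    by (intro finite_PiE) auto
  finally show ?thesis .
qed

text \<open>Negating the disjunction in \<open>W_set\<close> leaves two closed half-spaces, and
  \<open>\<Omega>_set\<close> contributes open ones; all are intersected with the hull.\<close>

lemma convex_V_set: "convex (V_set r p \<epsilon> i)"
proof -
  have "V_set r p \<epsilon> i = payoff_hull r p
      \<inter> (\<Inter>j\<in>UNIV - {i}. {x. (axis i 1 - axis j 1) \<bullet> x > - \<epsilon>})
      \<inter> {x. axis i 1 \<bullet> x \<ge> r 0} \<inter> {x. (\<Sum>j\<in>UNIV - {i}. axis j 1) \<bullet> x \<le> 2 * p 3}"
    by (auto simp: V_set_def \<Omega>_set_def W_set_def inner_axis' inner_sum_left
        not_less algebra_simps; fastforce)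
  then show ?thesis
    by (auto simp: payoff_hull_def
        intro!: convex_Int convex_INT convex_halfspace_gt convex_halfspace_ge convex_halfspace_le)
qed

lemma UNIV_3_minus_1: "UNIV - {1 :: 3} = {2, 3}"
  unfolding UNIV_3 by simp

text \<open>The payoff order is used here. Up to swapping players 2 and 3, the vectors are
  \<open>(r 0, r 0, r 0)\<close>, \<open>(r 1, p 1, r 1)\<close> and \<open>(r 2, p 2, p 2)\<close>;
  ties with player 1 are allowed because \<open>\<epsilon> > 0\<close>.\<close>

lemma payoff_in_V_set_if_NotInvest:
  assumes "r 0 < r 1" "r 1 < r 2" "p 1 < p 2" "p 2 < p 3" "p 1 < r 0" "r 0 < p 3"
    and "p 1 + r 1 < 2 * p 3" "p 2 < r 2" "\<epsilon> > 0"
    and "a 1 = NotInvest"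
  shows "payoff r p a \<in> V_set r p \<epsilon> 1"
proof -
  have investors: "{j. a j = Invest} =
      (if a 2 = Invest then {2} else {}) \<union> (if a 3 = Invest then {3} else {})"
    using assms(10) by (simp add: set_eq_iff forall_3)
  have "payoff r p a \<in> payoff_hull r p"
    unfolding payoff_hull_def by (intro hull_inc) auto
  then show ?thesis
    using assms
    by (cases "a 2"; cases "a 3")
      (simp_all add: V_set_def \<Omega>_set_def W_set_def UNIV_3_minus_1 forall_3 payoff_def investors
        flip: numeral_2_eq_2)
qed

theorem theorem3p3:
  fixes r p :: "nat \<Rightarrow> real" and \<epsilon> :: real
    and s2 s3 :: strategy and x1 :: "real^3" and X :: "nat \<Rightarrow> real^3"
  assumes "0 < r 0" "r 0 < r 1" "r 1 < r 2"
    and "0 < p 1" "p 1 < p 2" "p 2 < p 3"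
    and "p 1 < r 0"
    and "3 * r 0 < p 1 + 2 * r 1" "p 1 + 2 * r 1 < 2 * p 2 + r 2" "2 * p 2 + r 2 < 3 * p 3"
    and "p 1 + r 1 < 2 * p 3"
    and "p 2 < r 2"
    and "\<epsilon> > 0"
    and "x1 \<in> payoff_hull r p"
  defines "X \<equiv> trajectory (payoff r p \<circ> strategy_profile (good_strategy r p \<epsilon> 1) s2 s3) x1"
  shows "liminf (\<lambda>T. ereal (X T $ 1)) \<ge> ereal (r 0)
    \<and> limsup (\<lambda>T. ereal (X T $ 2 + X T $ 3)) \<le> ereal (2 * p 3)
    \<and> (\<lambda>T. infdist (X T) (V_set r p \<epsilon> 1)) \<longlonglongrightarrow> 0"
proof -
  let ?V = "V_set r p \<epsilon> 1"
  define u where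
    "u = (payoff r p \<circ> strategy_profile (good_strategy r p \<epsilon> 1) s2 s3) \<circ> X"
  \<comment> \<open>The recursion starts at 1: the dummy \<open>X 0\<close> equals
    \<open>X 1\<close>, so index 0 is excluded.\<close>
  have step: "X (Suc n) = (1 / (real n + 1)) *\<^sub>R (real n *\<^sub>R X n + u n)" if "n \<ge> 1" for n
    using that by (cases n) (simp_all add: X_def u_def Let_def)
  have outside: "u n \<in> ?V" if "X n \<notin> ?V" for n
    \<comment> \<open>The premise \<open>r 0 < p 3\<close> comes from the chain leading from
      \<open>3 * r 0\<close> to \<open>3 * p 3\<close>.\<close>
    unfolding u_def comp_def using assms(1-13) that
    by (intro payoff_in_V_set_if_NotInvest)
      (simp_all add: strategy_profile_def good_strategy_def)
  have u_hull: "u n \<in> payoff_hull r p" for n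
    unfolding payoff_hull_def u_def by (intro hull_inc) auto
  have "bounded (payoff_hull r p)"
    unfolding payoff_hull_def 
    by (intro bounded_convex_hull finite_imp_bounded finite_imageI finite_action_profiles)
  then have inside: "dist (u n) (X n) \<le> diameter (payoff_hull r p)" if "X n \<in> ?V" for n
    using that u_hull by (intro diameter_bounded_bound) (auto simp: V_set_def \<Omega>_set_def)
  have lim: "(\<lambda>T. infdist (X T) ?V) \<longlonglongrightarrow> 0"
    by (rule averaging_infdist_tendsto_0[OF convex_V_set step outside inside])

  \<comment> \<open>If the set were empty, \<open>X n\<close> would lie outside it and
    \<open>outside\<close> would put \<open>u n\<close> into it.\<close>
  have "?V \<noteq> {}"
    using outside by auto
  have V_bounds: "r 0 \<le> v $ 1" "v $ 2 + v $ 3 \<le> 2 * p 3" if "v \<in> ?V" for v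
    using that by (auto simp: V_set_def \<Omega>_set_def W_set_def UNIV_3_minus_1)
  have coord: "\<bar>x $ i - v $ i\<bar> \<le> dist x v" for x v :: "real^3" and i
    using component_le_norm_cart[of "x - v" i] by (simp add: dist_norm)
  \<comment> \<open>The set lies in a half-space bounding coordinate 1 from below, and coordinates
    are 1-Lipschitz.\<close>
  have low: "r 0 - infdist (X T) ?V \<le> X T $ 1" for T
  proof -
    have "r 0 - X T $ 1 \<le> infdist (X T) ?V"
      using \<open>?V \<noteq> {}\<close>
    proof (rule le_infdist)
      fix v assume v: "v \<in> ?V"
      show "r 0 - X T $ 1 \<le> dist (X T) v"
        using V_bounds(1)[OF v] coord[of "X T" 1 v] by linarith
    qed
    then show ?thesis by linarith
  qed
  \<comment> \<open>The factor 2 adds the Lipschitz constants of two coordinates; dividing by it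
    gives a lower bound on the distance, as \<open>le_infdist\<close> requires.\<close>
  have up: "X T $ 2 + X T $ 3 \<le> 2 * p 3 + 2 * infdist (X T) ?V" for T
  proof -
    have "(X T $ 2 + X T $ 3 - 2 * p 3) / 2 \<le> infdist (X T) ?V"
      using \<open>?V \<noteq> {}\<close>
    proof (rule le_infdist)
      fix v assume v: "v \<in> ?V"
      show "(X T $ 2 + X T $ 3 - 2 * p 3) / 2 \<le> dist (X T) v"
        using V_bounds(2)[OF v] coord[of "X T" 2 v] coord[of "X T" 3 v]
        unfolding abs_le_iff by argo
    qed
    then show ?thesis by (simp add: field_simps)
  qed

  have "(\<lambda>T. r 0 - infdist (X T) ?V) \<longlonglongrightarrow> r 0 - 0"
    by (intro tendsto_intros lim)
  then have "ereal (r 0) = liminf (\<lambda>T. ereal (r 0 - infdist (X T) ?V))"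
    by (intro lim_imp_Liminf[symmetric]) auto
  also have "\<dots> \<le> liminf (\<lambda>T. ereal (X T $ 1))"
    using low by (intro Liminf_mono) simp
  finally have 1: "ereal (r 0) \<le> liminf (\<lambda>T. ereal (X T $ 1))" .

  have "limsup (\<lambda>T. ereal (X T $ 2 + X T $ 3)) \<le> limsup (\<lambda>T. ereal (2 * p 3 + 2 * infdist (X T) ?V))"
    using up by (intro Limsup_mono) simp
  also have "(\<lambda>T. 2 * p 3 + 2 * infdist (X T) ?V) \<longlonglongrightarrow> 2 * p 3 + 2 * 0"
    by (intro tendsto_intros lim)
  then have "limsup (\<lambda>T. ereal (2 * p 3 + 2 * infdist (X T) ?V)) = ereal (2 * p 3)"
    by (intro lim_imp_Limsup) auto
  finally show ?thesis
    using 1 lim by blast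
qed

end
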